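(* Let $\boldsymbol f=(f_1,f_2):\mathbb R/L\mathbb Z\to\mathbb R^2$ be a smooth arc-length parametrized closed plane curve of length $L>0$ with rotation number $1$. Then the integral $\int_0^L\{\kappa^3\tilde\kappa+(\tilde\kappa')^2\}\,ds$ is non-negative, and $$I_0\le I_{-1}^{\frac12}\left[L^3\int_0^L\left\{\kappa^3\tilde\kappa+(\tilde\kappa')^2\right\}ds\right]^{\frac12}.$$ Equality (in this last inequality) never holds except in the trivial case $\tilde\kappa\equiv0$.
   Context: For an arc-length parametrized closed curve $\boldsymbol f=(f_1,f_2):\mathbb R/L\mathbb Z\to\mathbb R^2$ (so $\|\boldsymbol f'\|\equiv1$), let $\boldsymbol\nu=(-f_2',f_1')$, $\boldsymbol\kappa=\boldsymbol f''$, and let $\kappa=\boldsymbol\kappa\cdot\boldsymbol\nu$ be the curvature. The curve need not be simple or convex. Rotation number $1$ means $\int_0^L\kappa\,ds=2\pi$. The signed area is $A=-\frac12\int_0^L\boldsymbol f\cdot\boldsymbol\nu\,ds$. The deviation of curvature is $\tilde\kappa=\kappa-\frac1L\int_0^L\kappa\,ds=\kappa-\frac{2\pi}{L}$; primes denote derivatives in the arc-length parameter $s$. Set $$I_{-1}=1-\frac{4\pi A}{L^2},\qquad I_0=L\int_0^L\tilde\kappa^2\,ds.$$ By the isoperimetric inequality, $I_{-1}\ge0$. *)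

theory Defs
  imports "HOL-Analysis.Analysis"
begin

definition vderiv :: "(real \<Rightarrow> real ^ 2) \<Rightarrow> real \<Rightarrow> real ^ 2" where
  "vderiv f s = vector_derivative f (at s)"

definition smooth_curve :: "(real \<Rightarrow> real ^ 2) \<Rightarrow> bool" where
  "smooth_curve f \<longleftrightarrow> (\<forall>n s. (vderiv ^^ n) f differentiable (at s))"

text \<open>A map on the circle of length \<open>L\<close> is represented by its \<open>L\<close>-periodic lift to the real
  line, so derivatives at the endpoints of \<open>{0..L}\<close> are two-sided. The curve need not be simple.\<close>

definition arclength_closed_curve :: "real \<Rightarrow> (real \<Rightarrow> real ^ 2) \<Rightarrow> bool" where
  "arclength_closed_curve L f \<longleftrightarrow>
     smooth_curve f \<and> (\<forall>s. f (s + L) = f s) \<and> (\<forall>s. norm (vderiv f s) = 1)"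

definition nu :: "(real \<Rightarrow> real ^ 2) \<Rightarrow> real \<Rightarrow> real ^ 2" where
  "nu f s = vector [- (vderiv f s $ 2), vderiv f s $ 1]"

definition curvature_vector :: "(real \<Rightarrow> real ^ 2) \<Rightarrow> real \<Rightarrow> real ^ 2" where
  "curvature_vector f = vderiv (vderiv f)"

definition curvature :: "(real \<Rightarrow> real ^ 2) \<Rightarrow> real \<Rightarrow> real" where
  "curvature f s = curvature_vector f s \<bullet> nu f s"

definition rotation_number :: "real \<Rightarrow> (real \<Rightarrow> real ^ 2) \<Rightarrow> real" where
  "rotation_number L f = integral {0..L} (curvature f) / (2 * pi)"

text \<open>The minus sign makes the area positive for counterclockwise simple curves, since then
  \<open>nu f\<close> is the inner normal.\<close>

definition signed_area :: "real \<Rightarrow> (real \<Rightarrow> real ^ 2) \<Rightarrow> real" where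
  "signed_area L f = - (1 / 2) * integral {0..L} (\<lambda>s. f s \<bullet> nu f s)"

definition curvature_dev :: "real \<Rightarrow> (real \<Rightarrow> real ^ 2) \<Rightarrow> real \<Rightarrow> real" where
  "curvature_dev L f s = curvature f s - (1 / L) * integral {0..L} (curvature f)"

definition I_minus_one :: "real \<Rightarrow> (real \<Rightarrow> real ^ 2) \<Rightarrow> real" where
  "I_minus_one L f = 1 - 4 * pi * signed_area L f / L ^ 2"

definition I_zero :: "real \<Rightarrow> (real \<Rightarrow> real ^ 2) \<Rightarrow> real" where
  "I_zero L f = L * integral {0..L} (\<lambda>s. (curvature_dev L f s) ^ 2)"

end

theory Submission
  imports Defs
begin

text \<open>
Write \<open>\<omega> = 2 \<pi> / L\<close> and \<open>J\<close> for the rotation by a right angle, and consider on \<open>L\<close>-periodic maps into the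
plane the bilinear form
\<open>B(u, v) = \<integral> u' \<bullet> v' - \<omega> (J u) \<bullet> v'\<close> (\<open>iso_form\<close>). It is symmetric by integration by parts, and
\<open>B(u, u) \<ge> 0\<close> is a form of the isoperimetric inequality for arbitrarily parametrized curves, proved in
\<open>isoperimetric_periodic\<close>. The theorem is the Cauchy-Schwarz inequality
\<open>B(f'', f)\<^sup>2 \<le> B(f, f) B(f'', f'')\<close>, because for a unit speed curve of rotation number one the three values
have a geometric meaning (\<open>iso_form_position\<close>, \<open>iso_form_mixed\<close>, \<open>iso_form_curvature\<close>):
\<open>B(f, f)\<close> is \<open>L\<close> times the isoperimetric deficit, \<open>B(f'', f)\<close> is minus the integral of the squared
curvature deviation, and \<open>B(f'', f'')\<close> is the integral on the right hand side of the inequality. In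
particular the latter is nonnegative.

In terms of the Fourier coefficients \<open>a\<^sub>k\<close> of \<open>f\<close>, regarded as a complex function, these are up to constants the sums of
\<open>\<bar>a\<^sub>k\<bar>\<^sup>2\<close> with weights \<open>k (k - 1)\<close>, \<open>- k\<^sup>3 (k - 1)\<close> and \<open>k\<^sup>5 (k - 1)\<close>, and the point is that \<open>k (k - 1) \<ge> 0\<close> for every
integer \<open>k\<close>. The proof avoids Fourier series. Nonnegativity of \<open>B\<close> follows from Wirtinger's inequality
for antiperiodic functions after rotating \<open>u\<close> by a linearly growing angle, and that inequality is
obtained by completing a square with a solution of a Riccati equation.

If equality holds, then some \<open>u = f'' + t f\<close>, or \<open>f\<close> itself, is a null vector of \<open>B\<close> and hence solves
the Euler-Lagrange equation \<open>u'' = \<omega> J u'\<close> (\<open>iso_form_null\<close>). For \<open>u = f\<close> this says \<open>\<kappa> = \<omega>\<close>. For \<open>u = f'' + t f\<close> its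
tangential component is \<open>\<kappa>' (3 \<kappa> - \<omega>) = 0\<close>, which forces \<open>\<kappa>\<close> to be constant (\<open>rigid_combination\<close>).
\<close>

section \<open>Wirtinger inequalities on an interval\<close>

text \<open>The function \<open>\<phi>(s) = - \<mu> tan (\<mu> (s - c))\<close>, with \<open>c\<close> the midpoint, solves the Riccati equation
\<open>\<phi>' = - \<mu>\<^sup>2 - \<phi>\<^sup>2\<close>, so that
\<open>w'\<^sup>2 - \<mu>\<^sup>2 w\<^sup>2 = (w' - \<phi> w)\<^sup>2 + (\<phi> w\<^sup>2)'\<close>, and the last term integrates to zero because \<open>w\<close> vanishes
at both ends. Below the critical frequency \<open>\<phi>\<close> is smooth on the closed interval, so no singular
boundary terms occur; the sharp constant is reached by a limit in the next lemma.\<close>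
lemma wirtinger_subcritical:
  fixes w w' :: "real \<Rightarrow> real"
  assumes ab: "a < b" and w0: "w a = 0" "w b = 0"
    and w': "\<And>s. (w has_real_derivative w' s) (at s)" and cont: "continuous_on UNIV w'"
    and mu: "0 \<le> \<mu>" "\<mu> * (b - a) < pi"
  shows "\<mu>\<^sup>2 * integral {a..b} (\<lambda>s. (w s)\<^sup>2) \<le> integral {a..b} (\<lambda>s. (w' s)\<^sup>2)"
proof -
  define c where "c = (a + b) / 2"
  define \<phi> where "\<phi> s = - \<mu> * tan (\<mu> * (s - c))" for s
  have cosp: "cos (\<mu> * (s - c)) > 0" if "s \<in> {a..b}" for s
  proof -
    have "\<bar>s - c\<bar> \<le> (b - a) / 2" using that by (auto simp: c_def abs_le_iff field_simps)
    then have "\<bar>\<mu> * (s - c)\<bar> \<le> \<mu> * ((b - a) / 2)"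
      using mult_left_mono[OF _ mu(1)] mu(1) by (simp only: abs_mult abs_of_nonneg)
    then have "\<bar>\<mu> * (s - c)\<bar> < pi / 2" using mu(2) by simp
    then show ?thesis by (intro cos_gt_zero_pi) auto
  qed
  have \<phi>': "(\<phi> has_real_derivative - \<mu>\<^sup>2 - (\<phi> s)\<^sup>2) (at s)" if "s \<in> {a..b}" for s
  proof -
    have "inverse ((cos (\<mu> * (s - c)))\<^sup>2) = 1 + (tan (\<mu> * (s - c)))\<^sup>2"
      using cosp[OF that] by (simp add: tan_sec power_inverse)
    then show ?thesis
      unfolding \<phi>_def using cosp[OF that]
      by (auto intro!: derivative_eq_intros simp: power_mult_distrib)
         (simp add: algebra_simps power2_eq_square)
  qed
  have wc: "continuous_on A w" for A
    by (rule continuous_at_imp_continuous_on) (use w' DERIV_isCont in blast)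
  have w'c: "continuous_on A w'" for A using cont continuous_on_subset by blast
  have \<phi>c: "continuous_on {a..b} \<phi>"
    by (rule continuous_at_imp_continuous_on) (use \<phi>' DERIV_isCont in blast)
  \<comment> \<open>the derivative of \<open>\<phi> w\<^sup>2\<close>, after insertion of the Riccati equation\<close>
  let ?b = "\<lambda>s. 2 * \<phi> s * w s * w' s + (- \<mu>\<^sup>2 - (\<phi> s)\<^sup>2) * (w s)\<^sup>2"
  have "(?b has_integral (\<phi> b * (w b)\<^sup>2 - \<phi> a * (w a)\<^sup>2)) {a..b}"
  proof (rule fundamental_theorem_of_calculus)
    show "a \<le> b" using ab by simp
    fix s assume s: "s \<in> {a..b}"
    have "((\<lambda>s. \<phi> s * (w s)\<^sup>2) has_real_derivative ?b s) (at s)"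
      by (auto intro!: derivative_eq_intros \<phi>'[OF s] w')
    then show "((\<lambda>s. \<phi> s * (w s)\<^sup>2) has_vector_derivative ?b s) (at s within {a..b})"
      by (simp add: has_real_derivative_iff_has_vector_derivative has_vector_derivative_at_within)
  qed
  then have b: "(?b has_integral 0) {a..b}" using w0 by simp
  have sq: "(\<lambda>s. (w' s - \<phi> s * w s)\<^sup>2) integrable_on {a..b}"
    by (intro integrable_continuous_real continuous_intros wc w'c \<phi>c)
  have "((\<lambda>s. (w' s - \<phi> s * w s)\<^sup>2 + ?b s)
      has_integral (integral {a..b} (\<lambda>s. (w' s - \<phi> s * w s)\<^sup>2) + 0)) {a..b}"
    by (intro has_integral_add b integrable_integral sq)
  moreover have "(\<lambda>s. (w' s - \<phi> s * w s)\<^sup>2 + ?b s) = (\<lambda>s. (w' s)\<^sup>2 - \<mu>\<^sup>2 * (w s)\<^sup>2)"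
    by (auto simp: fun_eq_iff power2_eq_square algebra_simps)
  ultimately have "integral {a..b} (\<lambda>s. (w' s)\<^sup>2 - \<mu>\<^sup>2 * (w s)\<^sup>2)
      = integral {a..b} (\<lambda>s. (w' s - \<phi> s * w s)\<^sup>2)"
    by (simp add: integral_unique)
  also have "\<dots> \<ge> 0" by (intro integral_nonneg sq) auto
  finally have "0 \<le> integral {a..b} (\<lambda>s. (w' s)\<^sup>2 - \<mu>\<^sup>2 * (w s)\<^sup>2)" .
  also have "\<dots> = integral {a..b} (\<lambda>s. (w' s)\<^sup>2) - \<mu>\<^sup>2 * integral {a..b} (\<lambda>s. (w s)\<^sup>2)"
    by (subst integral_diff) (auto intro!: integrable_continuous_real continuous_intros wc w'c)
  finally show ?thesis by simp
qed

lemma wirtinger_dirichlet: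
  fixes w w' :: "real \<Rightarrow> real"
  assumes ab: "a < b" and w0: "w a = 0" "w b = 0"
    and w': "\<And>s. (w has_real_derivative w' s) (at s)" and cont: "continuous_on UNIV w'"
  shows "(pi / (b - a))\<^sup>2 * integral {a..b} (\<lambda>s. (w s)\<^sup>2) \<le> integral {a..b} (\<lambda>s. (w' s)\<^sup>2)"
proof (rule tendsto_upperbound)
  let ?M = "pi / (b - a)"
  show "((\<lambda>\<mu>. \<mu>\<^sup>2 * integral {a..b} (\<lambda>s. (w s)\<^sup>2)) \<longlongrightarrow> ?M\<^sup>2 * integral {a..b} (\<lambda>s. (w s)\<^sup>2)) (at_left ?M)"
    by (intro tendsto_intros)
  have "0 < ?M" using ab by simp
  then have "eventually (\<lambda>\<mu>. \<mu> \<in> {0<..<?M}) (at_left ?M)" by (rule eventually_at_left_real)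
  then show "eventually (\<lambda>\<mu>. \<mu>\<^sup>2 * integral {a..b} (\<lambda>s. (w s)\<^sup>2) \<le> integral {a..b} (\<lambda>s. (w' s)\<^sup>2)) (at_left ?M)"
  proof eventually_elim
    case (elim \<mu>)
    show ?case
      by (rule wirtinger_subcritical[OF assms]) (use elim ab in \<open>auto simp: field_simps\<close>)
  qed
qed simp

text \<open>An antiperiodic function need not vanish at \<open>0\<close>; the lemma allows the integrals to be moved to a
period that starts at one of its zeros.\<close>
lemma integral_periodic_shift:
  fixes g :: "real \<Rightarrow> real"
  assumes per: "\<And>s. g (s + L) = g s" and cont: "continuous_on UNIV g" and a: "a \<in> {0..L}"
  shows "integral {a..a + L} g = integral {0..L} g"
proof -
  have int: "g integrable_on {c..d}" for c d
    by (intro integrable_continuous_real continuous_on_subset[OF cont]) auto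
  have "integral {a..a+L} g = integral {a..L} g + integral {L..a+L} g"
    using a by (intro Henstock_Kurzweil_Integration.integral_combine[symmetric] int) auto
  also have "integral {L..a+L} g = integral {0..a} (\<lambda>s. g (s + L))"
    using integral_shift_real_ivl[of L L "a + L" g] by simp
  also have "\<dots> = integral {0..a} g" using per by simp
  also have "integral {a..L} g + integral {0..a} g = integral {0..L} g"
    using Henstock_Kurzweil_Integration.integral_combine[of 0 a L g] a int by auto
  finally show ?thesis .
qed

text \<open>An antiperiodic function takes values of opposite sign at \<open>0\<close> and \<open>L\<close>, hence has a zero \<open>a\<close>; it
then vanishes at \<open>a + L\<close> too, and the Dirichlet case applies on \<open>{a..a + L}\<close>.\<close>
lemma wirtinger_antiperiodic:
  fixes w w' :: "real \<Rightarrow> real"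
  assumes L: "0 < L" and anti: "\<And>s. w (s + L) = - w s"
    and w': "\<And>s. (w has_real_derivative w' s) (at s)" and cont: "continuous_on UNIV w'"
  shows "(pi / L)\<^sup>2 * integral {0..L} (\<lambda>s. (w s)\<^sup>2) \<le> integral {0..L} (\<lambda>s. (w' s)\<^sup>2)"
proof -
  have wc: "continuous_on A w" for A
    by (rule continuous_at_imp_continuous_on) (use w' DERIV_isCont in blast)
  have wL: "w L = - w 0" using anti[of 0] by simp
  obtain a where a: "a \<in> {0..L}" "w a = 0"
  proof (cases "w 0 \<le> 0")
    case True
    then show ?thesis using IVT'[of w 0 0 L] that wL L wc by auto
  next
    case False
    then show ?thesis using IVT2'[of w L 0 0] that wL L wc by auto
  qed
  have anti': "w' (s + L) = - w' s" for s
  proof -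
    have "((\<lambda>s. w (s + L)) has_real_derivative w' (s + L)) (at s)"
      using w'[of "s + L"] by (simp add: DERIV_shift)
    moreover have "((\<lambda>s. w (s + L)) has_real_derivative - w' s) (at s)"
      unfolding anti by (intro derivative_intros w')
    ultimately show ?thesis by (rule DERIV_unique)
  qed
  have "(pi / L)\<^sup>2 * integral {a..a+L} (\<lambda>s. (w s)\<^sup>2) \<le> integral {a..a+L} (\<lambda>s. (w' s)\<^sup>2)"
    using wirtinger_dirichlet[OF _ a(2) _ w' cont, of "a + L"] L a anti by simp
  moreover have "integral {a..a+L} (\<lambda>s. (w s)\<^sup>2) = integral {0..L} (\<lambda>s. (w s)\<^sup>2)"
    by (intro integral_periodic_shift a) (auto simp: anti intro!: continuous_intros wc)
  moreover have "integral {a..a+L} (\<lambda>s. (w' s)\<^sup>2) = integral {0..L} (\<lambda>s. (w' s)\<^sup>2)"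
    by (intro integral_periodic_shift a) (auto simp: anti' intro!: continuous_intros cont)
  ultimately show ?thesis by simp
qed

section \<open>The isoperimetric inequality for periodic plane maps\<close>

definition rot90 :: "real ^ 2 \<Rightarrow> real ^ 2" where
  "rot90 v = vector [- (v $ 2), v $ 1]"

lemma rot90_nth [simp]: "rot90 v $ 1 = - (v $ 2)" "rot90 v $ 2 = v $ 1"
  by (simp_all add: rot90_def)

lemma inner_real2: "(v :: real ^ 2) \<bullet> w = v $ 1 * w $ 1 + v $ 2 * w $ 2"
  by (simp add: inner_vec_def sum_2)

lemma linear_rot90: "linear rot90"
  by (rule linearI) (simp_all add: vec_eq_iff forall_2)

text \<open>Rotating \<open>u(s)\<close> by the angle \<open>- \<pi> s / L\<close> gives a map \<open>w\<close> which is antiperiodic, since the rotation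
by \<open>- \<pi>\<close> over one period is minus the identity. A pointwise computation turns the integrand into
\<open>\<bar>w'\<bar>\<^sup>2 - (\<pi> / L)\<^sup>2 \<bar>w\<bar>\<^sup>2\<close>, and each component obeys the Wirtinger inequality for antiperiodic functions.
The twist removes the need to subtract the mean of \<open>u\<close>: constant maps become multiples of
extremal functions.\<close>
lemma isoperimetric_periodic:
  fixes u u' :: "real \<Rightarrow> real ^ 2"
  assumes L: "0 < L" and per: "\<And>s. u (s + L) = u s"
    and u': "\<And>s. (u has_vector_derivative u' s) (at s)" and cont: "continuous_on UNIV u'"
  shows "0 \<le> integral {0..L} (\<lambda>s. u' s \<bullet> u' s - 2 * pi / L * (rot90 (u s) \<bullet> u' s))"
proof -
  define h where "h = pi / L"
  have hL: "h * L = pi" using L by (simp add: h_def)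
  define w1 where "w1 s = u s $ 1 * cos (h * s) + u s $ 2 * sin (h * s)" for s
  define w2 where "w2 s = u s $ 2 * cos (h * s) - u s $ 1 * sin (h * s)" for s
  define w1' where "w1' s = u' s $ 1 * cos (h * s) + u' s $ 2 * sin (h * s) + h * w2 s" for s
  define w2' where "w2' s = u' s $ 2 * cos (h * s) - u' s $ 1 * sin (h * s) - h * w1 s" for s
  have c: "((\<lambda>s. u s $ i) has_real_derivative u' s $ i) (at s)" for i s
    using bounded_linear.has_vector_derivative[OF bounded_linear_vec_nth u']
    by (simp add: has_real_derivative_iff_has_vector_derivative)
  have uc: "continuous_on UNIV u"
    by (rule continuous_at_imp_continuous_on) (use u' has_vector_derivative_continuous in blast)
  have w1: "(w1 has_real_derivative w1' s) (at s)" for s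
    unfolding w1_def w1'_def w2_def
    by (auto intro!: derivative_eq_intros c simp: algebra_simps)
  have w2: "(w2 has_real_derivative w2' s) (at s)" for s
    unfolding w2_def w2'_def w1_def
    by (auto intro!: derivative_eq_intros c simp: algebra_simps)
  have wc: "continuous_on UNIV w1" "continuous_on UNIV w2"
    unfolding w1_def w2_def by (intro continuous_intros uc)+
  have w'c: "continuous_on UNIV w1'" "continuous_on UNIV w2'"
    unfolding w1'_def w2'_def by (intro continuous_intros wc cont)+
  have anti: "w1 (s + L) = - w1 s" "w2 (s + L) = - w2 s" for s
    unfolding w1_def w2_def by (simp_all add: per distrib_left hL)
  have int: "(\<lambda>s. (g s)\<^sup>2) integrable_on {0..L}" if "continuous_on UNIV g" for g :: "real \<Rightarrow> real"
    by (intro integrable_continuous_real continuous_intros continuous_on_subset[OF that]) auto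
  have tw: "u' s \<bullet> u' s - 2 * pi / L * (rot90 (u s) \<bullet> u' s)
      = ((w1' s)\<^sup>2 - h\<^sup>2 * (w1 s)\<^sup>2) + ((w2' s)\<^sup>2 - h\<^sup>2 * (w2 s)\<^sup>2)" for s
  proof -
    have sc: "(sin (h * s))\<^sup>2 = 1 - (cos (h * s))\<^sup>2"
      by (simp add: sin_squared_eq)
    have "2 * pi / L = 2 * h" by (simp add: h_def)
    then show ?thesis
      unfolding w1'_def w2'_def w1_def w2_def inner_real2 rot90_nth
      using sc by simp algebra
  qed
  have "integral {0..L} (\<lambda>s. u' s \<bullet> u' s - 2 * pi / L * (rot90 (u s) \<bullet> u' s))
    = (integral {0..L} (\<lambda>s. (w1' s)\<^sup>2) - h\<^sup>2 * integral {0..L} (\<lambda>s. (w1 s)\<^sup>2))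
      + (integral {0..L} (\<lambda>s. (w2' s)\<^sup>2) - h\<^sup>2 * integral {0..L} (\<lambda>s. (w2 s)\<^sup>2))"
    unfolding tw using int wc w'c
    by (simp add: integral_add integral_diff integrable_diff integrable_on_mult_right)
  moreover have "h\<^sup>2 * integral {0..L} (\<lambda>s. (w1 s)\<^sup>2) \<le> integral {0..L} (\<lambda>s. (w1' s)\<^sup>2)"
    unfolding h_def by (rule wirtinger_antiperiodic[OF L anti(1) w1 w'c(1)])
  moreover have "h\<^sup>2 * integral {0..L} (\<lambda>s. (w2 s)\<^sup>2) \<le> integral {0..L} (\<lambda>s. (w2' s)\<^sup>2)"
    unfolding h_def by (rule wirtinger_antiperiodic[OF L anti(2) w2 w'c(2)])
  ultimately show ?thesis by simp
qed

section \<open>Smooth periodic maps\<close>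

definition smooth_loop :: "real \<Rightarrow> (real \<Rightarrow> real ^ 2) \<Rightarrow> bool" where
  "smooth_loop L u \<longleftrightarrow> smooth_curve u \<and> (\<forall>s. u (s + L) = u s)"

lemma vderiv_iterate: "(vderiv ^^ n) (vderiv u) = (vderiv ^^ Suc n) u"
  by (simp add: funpow_swap1)

lemma smooth_curve_has_vderiv:
  assumes "smooth_curve u"
  shows "(u has_vector_derivative vderiv u s) (at s)"
proof -
  have "(vderiv ^^ 0) u differentiable at s" using assms unfolding smooth_curve_def by blast
  then show ?thesis by (simp add: vderiv_def vector_derivative_works)
qed

lemma smooth_curve_vderiv: "smooth_curve u \<Longrightarrow> smooth_curve (vderiv u)"
  unfolding smooth_curve_def vderiv_iterate by blast

lemma vderiv_eqI:
  assumes "\<And>s. (u has_vector_derivative u' s) (at s)"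
  shows "vderiv u = u'"
  using assms by (simp add: fun_eq_iff vderiv_def vector_derivative_at)

text \<open>Sums, scalar multiples and rotations of smooth maps are all of the form \<open>A \<circ> u + B \<circ> v\<close> with \<open>A\<close>
and \<open>B\<close> linear.\<close>
lemma
  assumes u: "smooth_curve u" and v: "smooth_curve v" and A: "linear A" and B: "linear B"
  shows vderiv_lincomb: "vderiv (\<lambda>s. A (u s) + B (v s)) = (\<lambda>s. A (vderiv u s) + B (vderiv v s))"
    and smooth_curve_lincomb: "smooth_curve (\<lambda>s. A (u s) + B (v s))"
proof -
  have d: "((\<lambda>s. A (u s) + B (v s)) has_vector_derivative A (vderiv u s) + B (vderiv v s)) (at s)"
    if "smooth_curve u" "smooth_curve v" for u v s
    using A B smooth_curve_has_vderiv[OF that(1)] smooth_curve_has_vderiv[OF that(2)]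
    by (simp add: linear_conv_bounded_linear bounded_linear.has_vector_derivative
        has_vector_derivative_add)
  have e: "vderiv (\<lambda>s. A (u s) + B (v s)) = (\<lambda>s. A (vderiv u s) + B (vderiv v s))"
    if "smooth_curve u" "smooth_curve v" for u v
    by (intro vderiv_eqI d that)
  then show "vderiv (\<lambda>s. A (u s) + B (v s)) = (\<lambda>s. A (vderiv u s) + B (vderiv v s))"
    using u v .
  have "(vderiv ^^ n) (\<lambda>s. A (u s) + B (v s)) differentiable at s"
    if "smooth_curve u" "smooth_curve v" for n u v s
    using that
  proof (induction n arbitrary: u v)
    case 0
    then show ?case using d[of u v s] by (simp add: differentiableI_vector)
  next
    case (Suc n)
    have "(vderiv ^^ Suc n) (\<lambda>s. A (u s) + B (v s))
        = (vderiv ^^ n) (\<lambda>s. A (vderiv u s) + B (vderiv v s))"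
      by (simp only: vderiv_iterate[symmetric] e[OF Suc.prems])
    then show ?case using Suc.IH Suc.prems smooth_curve_vderiv by simp
  qed
  then show "smooth_curve (\<lambda>s. A (u s) + B (v s))" using u v by (simp add: smooth_curve_def)
qed

lemma smooth_loop_lincomb:
  assumes "smooth_loop L u" "smooth_loop L v" "linear A" "linear B"
  shows "smooth_loop L (\<lambda>s. A (u s) + B (v s))"
  using assms by (simp add: smooth_loop_def smooth_curve_lincomb)

lemma smooth_loop_vderiv:
  assumes "smooth_loop L u"
  shows "smooth_loop L (vderiv u)"
proof -
  have u: "(u has_vector_derivative vderiv u s) (at s)" for s
    using assms by (simp add: smooth_loop_def smooth_curve_has_vderiv)
  have "vderiv u (s + L) = vderiv u s" for s
  proof -
    have "((\<lambda>s. u (s + L)) has_vector_derivative vderiv u (s + L)) (at s)"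
      using vector_diff_chain_at[of "\<lambda>s. s + L" 1 s u "vderiv u (s + L)"] u
      by (simp add: o_def has_vector_derivative_add_const)
    moreover have "(\<lambda>s. u (s + L)) = u" using assms by (simp add: smooth_loop_def)
    ultimately show ?thesis using u vector_derivative_unique_at by metis
  qed
  then show ?thesis using assms by (simp add: smooth_loop_def smooth_curve_vderiv)
qed

lemma continuous_on_smooth_curve: "smooth_curve u \<Longrightarrow> continuous_on A u"
  by (rule continuous_at_imp_continuous_on)
     (use smooth_curve_has_vderiv has_vector_derivative_continuous in blast)

lemma continuous_on_smooth_loop: "smooth_loop L u \<Longrightarrow> continuous_on A u"
  by (simp add: smooth_loop_def continuous_on_smooth_curve)

lemma integral_by_parts_loop:
  assumes L: "0 < L" and u: "smooth_loop L u" and v: "smooth_loop L v"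
  shows "integral {0..L} (\<lambda>s. vderiv u s \<bullet> v s) = - integral {0..L} (\<lambda>s. u s \<bullet> vderiv v s)"
proof -
  have d: "((\<lambda>s. u s \<bullet> v s) has_vector_derivative u s \<bullet> vderiv v s + vderiv u s \<bullet> v s) (at s within {0..L})" for s
    using bounded_bilinear.has_vector_derivative[OF bounded_bilinear_inner
        smooth_curve_has_vderiv smooth_curve_has_vderiv] u v
    by (simp add: smooth_loop_def has_vector_derivative_at_within)
  have "((\<lambda>s. u s \<bullet> vderiv v s + vderiv u s \<bullet> v s) has_integral (u L \<bullet> v L - u 0 \<bullet> v 0)) {0..L}"
    using L d by (intro fundamental_theorem_of_calculus) auto
  moreover have "u L = u 0" "v L = v 0" using u v by (metis add_0 smooth_loop_def)+
  ultimately have "integral {0..L} (\<lambda>s. u s \<bullet> vderiv v s + vderiv u s \<bullet> v s) = 0"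
    by (simp add: integral_unique)
  moreover have "integral {0..L} (\<lambda>s. u s \<bullet> vderiv v s + vderiv u s \<bullet> v s)
      = integral {0..L} (\<lambda>s. u s \<bullet> vderiv v s) + integral {0..L} (\<lambda>s. vderiv u s \<bullet> v s)"
    using continuous_on_smooth_loop u v smooth_loop_vderiv
    by (intro integral_add integrable_continuous_real continuous_intros) blast+
  ultimately show ?thesis by simp
qed

section \<open>The isoperimetric form\<close>

text \<open>The bilinear form whose quadratic form is the left hand side of the isoperimetric inequality. On
the Fourier mode \<open>exp (2 \<pi> i k s / L)\<close> it is diagonal, with eigenvalue proportional to
\<open>k\<^sup>2 - k = k (k - 1)\<close>.\<close>
definition iso_form :: "real \<Rightarrow> (real \<Rightarrow> real ^ 2) \<Rightarrow> (real \<Rightarrow> real ^ 2) \<Rightarrow> real" where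
  "iso_form L u v =
     integral {0..L} (\<lambda>s. vderiv u s \<bullet> vderiv v s - 2 * pi / L * (rot90 (u s) \<bullet> vderiv v s))"

text \<open>Minus the second order operator that represents the isoperimetric form with respect to the square integral
inner product.\<close>
definition iso_op :: "real \<Rightarrow> (real \<Rightarrow> real ^ 2) \<Rightarrow> real \<Rightarrow> real ^ 2" where
  "iso_op L u s = vderiv (vderiv u) s - (2 * pi / L) *\<^sub>R rot90 (vderiv u s)"

lemma linear_scaleR_id: "linear (\<lambda>x::real^2. c *\<^sub>R x)"
  by (rule linearI) (simp_all add: algebra_simps)

lemma linear_scaleR_rot90: "linear (\<lambda>x. c *\<^sub>R rot90 x)"
  using linear_compose_scale_right[OF linear_rot90] .

lemma smooth_loop_add_scaleR:
  assumes "smooth_loop L u" "smooth_loop L v"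
  shows "smooth_loop L (\<lambda>s. u s + c *\<^sub>R v s)"
  using smooth_loop_lincomb[OF assms linear_ident linear_scaleR_id[of c]] by simp

lemma vderiv_add_scaleR:
  assumes "smooth_loop L u" "smooth_loop L v"
  shows "vderiv (\<lambda>s. u s + c *\<^sub>R v s) = (\<lambda>s. vderiv u s + c *\<^sub>R vderiv v s)"
  using vderiv_lincomb[OF _ _ linear_ident linear_scaleR_id[of c], of u v] assms
  by (simp add: smooth_loop_def)

lemma smooth_loop_iso_op:
  assumes "smooth_loop L u"
  shows "smooth_loop L (iso_op L u)"
proof -
  have "smooth_loop L (\<lambda>s. vderiv (vderiv u) s + (- (2 * pi / L)) *\<^sub>R rot90 (vderiv u s))"
    by (rule smooth_loop_lincomb[OF _ _ linear_ident linear_scaleR_rot90])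
       (intro smooth_loop_vderiv assms)+
  then show ?thesis by (simp add: iso_op_def[abs_def])
qed

lemma continuous_on_rot90 [continuous_intros]:
  "continuous_on A u \<Longrightarrow> continuous_on A (\<lambda>s. rot90 (u s))"
  using linear_rot90 by (simp add: linear_conv_bounded_linear bounded_linear.continuous_on)

lemma iso_form_integrand_integrable:
  assumes "smooth_loop L u" "smooth_loop L v"
  shows "(\<lambda>s. vderiv u s \<bullet> vderiv v s - 2 * pi / L * (rot90 (u s) \<bullet> vderiv v s)) integrable_on {0..L}"
  using continuous_on_smooth_loop assms smooth_loop_vderiv
  by (intro integrable_continuous_real continuous_intros) blast+

lemma iso_form_add_scaleR_left:
  assumes u: "smooth_loop L u" and v: "smooth_loop L v" and w: "smooth_loop L w"
  shows "iso_form L (\<lambda>s. u s + c *\<^sub>R v s) w = iso_form L u w + c * iso_form L v w"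
proof -
  have "iso_form L u w + c * iso_form L v w = integral {0..L} (\<lambda>s.
      (vderiv u s \<bullet> vderiv w s - 2 * pi / L * (rot90 (u s) \<bullet> vderiv w s))
      + c * (vderiv v s \<bullet> vderiv w s - 2 * pi / L * (rot90 (v s) \<bullet> vderiv w s)))"
    unfolding iso_form_def
    using iso_form_integrand_integrable[OF u w] iso_form_integrand_integrable[OF v w]
    by (simp add: integral_add integrable_on_mult_right)
  then show ?thesis
    by (simp add: iso_form_def vderiv_add_scaleR[OF u v] linear_add[OF linear_rot90]
      linear_scale[OF linear_rot90] inner_left_distrib algebra_simps)
qed

lemma iso_form_eq_iso_op:
  assumes L: "0 < L" and u: "smooth_loop L u" and v: "smooth_loop L v"
  shows "iso_form L u v = - integral {0..L} (\<lambda>s. u s \<bullet> iso_op L v s)"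
proof -
  note c = continuous_on_smooth_loop[OF u] continuous_on_smooth_loop[OF smooth_loop_vderiv[OF u]]
    continuous_on_smooth_loop[OF smooth_loop_vderiv[OF v]]
    continuous_on_smooth_loop[OF smooth_loop_vderiv[OF smooth_loop_vderiv[OF v]]]
  have r: "rot90 x \<bullet> y = - (x \<bullet> rot90 y)" for x y by (simp add: inner_real2)
  have i1: "(\<lambda>s. vderiv u s \<bullet> vderiv v s) integrable_on {0..L}"
    and i2: "(\<lambda>s. u s \<bullet> rot90 (vderiv v s)) integrable_on {0..L}"
    and i3: "(\<lambda>s. u s \<bullet> vderiv (vderiv v) s) integrable_on {0..L}"
    by (intro integrable_continuous_real continuous_intros c)+
  define k where "k = 2 * pi / L"
  have "iso_form L u v = integral {0..L} (\<lambda>s. vderiv u s \<bullet> vderiv v s)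
      + k * integral {0..L} (\<lambda>s. u s \<bullet> rot90 (vderiv v s))"
    unfolding iso_form_def r k_def[symmetric] using i1 i2
    by (simp add: integral_add integrable_on_mult_right)
  also have "\<dots> = - (integral {0..L} (\<lambda>s. u s \<bullet> vderiv (vderiv v) s)
      - k * integral {0..L} (\<lambda>s. u s \<bullet> rot90 (vderiv v s)))"
    by (simp add: integral_by_parts_loop[OF L u smooth_loop_vderiv[OF v]])
  also have "\<dots> = - integral {0..L} (\<lambda>s. u s \<bullet> iso_op L v s)"
    unfolding iso_op_def k_def[symmetric] inner_diff_right inner_scaleR_right using i2 i3
    by (simp add: integral_diff integrable_on_mult_right)
  finally show ?thesis .
qed

lemma iso_form_sym:
  assumes L: "0 < L" and u: "smooth_loop L u" and v: "smooth_loop L v"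
  shows "iso_form L u v = iso_form L v u"
proof -
  note c = continuous_on_smooth_loop[OF u] continuous_on_smooth_loop[OF v]
    continuous_on_smooth_loop[OF smooth_loop_vderiv[OF u]]
    continuous_on_smooth_loop[OF smooth_loop_vderiv[OF v]]
  have J: "smooth_loop L (\<lambda>s. rot90 (u s))" "vderiv (\<lambda>s. rot90 (u s)) = (\<lambda>s. rot90 (vderiv u s))"
    using smooth_loop_lincomb[OF u u linear_rot90 linear_zero]
      vderiv_lincomb[OF _ _ linear_rot90 linear_zero, of u u] u by (simp_all add: smooth_loop_def)
  have r: "rot90 x \<bullet> y = - (rot90 y \<bullet> x)" for x y by (simp add: inner_real2)
  have "integral {0..L} (\<lambda>s. rot90 (u s) \<bullet> vderiv v s) = - integral {0..L} (\<lambda>s. rot90 (vderiv u s) \<bullet> v s)"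
    using integral_by_parts_loop[OF L J(1) v] J(2) by simp
  also have "\<dots> = integral {0..L} (\<lambda>s. rot90 (v s) \<bullet> vderiv u s)"
    by (subst r) simp
  finally have "integral {0..L} (\<lambda>s. rot90 (u s) \<bullet> vderiv v s) = integral {0..L} (\<lambda>s. rot90 (v s) \<bullet> vderiv u s)" .
  moreover have "(\<lambda>s. vderiv u s \<bullet> vderiv v s) integrable_on {0..L}"
    "(\<lambda>s. vderiv v s \<bullet> vderiv u s) integrable_on {0..L}"
    "(\<lambda>s. rot90 (u s) \<bullet> vderiv v s) integrable_on {0..L}"
    "(\<lambda>s. rot90 (v s) \<bullet> vderiv u s) integrable_on {0..L}"
    by (intro integrable_continuous_real continuous_intros c)+
  moreover define k where "k = 2 * pi / L"
  ultimately show ?thesis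
    unfolding iso_form_def k_def[symmetric]
    by (simp add: integral_diff integrable_on_mult_right inner_commute[of "vderiv u _" "vderiv v _"])
qed

lemma iso_form_nonneg:
  assumes L: "0 < L" and u: "smooth_loop L u"
  shows "0 \<le> iso_form L u u"
  unfolding iso_form_def using L u
  by (intro isoperimetric_periodic smooth_curve_has_vderiv continuous_on_smooth_curve smooth_curve_vderiv)
     (auto simp: smooth_loop_def)

lemma iso_form_quadratic:
  assumes L: "0 < L" and u: "smooth_loop L u" and v: "smooth_loop L v"
  shows "iso_form L (\<lambda>s. u s + t *\<^sub>R v s) (\<lambda>s. u s + t *\<^sub>R v s)
     = iso_form L u u + 2 * t * iso_form L u v + t\<^sup>2 * iso_form L v v"
proof -
  note w = smooth_loop_add_scaleR[OF u v, of t]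
  note s = iso_form_sym[OF L _ w]
  show ?thesis
    by (simp add: iso_form_add_scaleR_left[OF u v] w s[OF u] s[OF v] u v iso_form_sym[OF L v u]
        power2_eq_square algebra_simps)
qed

text \<open>The form has a kernel, namely constants and counterclockwise circles of period \<open>L\<close>, so a vanishing
\<open>iso_form L v v\<close> has to be treated separately: then the quadratic polynomial in \<open>t\<close> is affine and
bounded below.\<close>
lemma iso_form_Cauchy_Schwarz:
  assumes L: "0 < L" and u: "smooth_loop L u" and v: "smooth_loop L v"
  shows "(iso_form L u v)\<^sup>2 \<le> iso_form L u u * iso_form L v v"
proof -
  let ?a = "iso_form L u u" and ?b = "iso_form L u v" and ?c = "iso_form L v v"
  have q: "0 \<le> ?a + 2 * t * ?b + t\<^sup>2 * ?c" for t
    using iso_form_nonneg[OF L smooth_loop_add_scaleR[OF u v, of t]] iso_form_quadratic[OF L u v] by simp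
  show ?thesis
  proof (cases "?c = 0")
    case True
    have "?b = 0"
    proof (rule ccontr)
      assume "?b \<noteq> 0"
      then show False using q[of "- (?a + 1) / (2 * ?b)"] True by (simp add: field_simps)
    qed
    then show ?thesis using True by simp
  next
    case False
    then have "?c > 0" using iso_form_nonneg[OF L v] by simp
    then show ?thesis using q[of "- ?b / ?c"] by (simp add: field_simps power2_eq_square)
  qed
qed

lemma periodic_eq_on_period:
  fixes g :: "real \<Rightarrow> 'a"
  assumes L: "0 < L" and per: "\<And>s. g (s + L) = g s"
  obtains r where "r \<in> {0..L}" "g s = g r"
proof
  interpret periodic_fun_simple g L by unfold_locales (rule per)
  define x where "x = real_of_int \<lfloor>s / L\<rfloor>"
  show "g s = g (s - x * L)" unfolding x_def by (rule minus_of_int[symmetric])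
  have "x \<le> s / L" "s / L \<le> x + 1" unfolding x_def by linarith+
  then show "s - x * L \<in> {0..L}" using L by (simp add: field_simps)
qed

text \<open>By Cauchy-Schwarz a null vector \<open>u\<close> of a nonnegative form is orthogonal to every vector. Testing with
\<open>iso_op L u\<close> itself gives that the integral of \<open>\<bar>iso_op L u\<bar>\<^sup>2\<close> is zero.\<close>
lemma iso_form_null:
  assumes L: "0 < L" and u: "smooth_loop L u" and null: "iso_form L u u = 0"
  shows "iso_op L u s = 0"
proof -
  note D = smooth_loop_iso_op[OF u]
  have "(iso_form L (iso_op L u) u)\<^sup>2 \<le> 0"
    using iso_form_Cauchy_Schwarz[OF L D u] null by simp
  then have "integral {0..L} (\<lambda>s. iso_op L u s \<bullet> iso_op L u s) = 0"
    using iso_form_eq_iso_op[OF L D u] by simp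
  then have "\<forall>s\<in>{0..L}. iso_op L u s \<bullet> iso_op L u s = 0"
    by (subst (asm) integral_eq_0_iff)
       (auto intro!: continuous_intros continuous_on_smooth_loop[OF D] L)
  then show ?thesis
    using periodic_eq_on_period[OF L, of "iso_op L u" s] D by (auto simp: smooth_loop_def)
qed

section \<open>Unit speed curves of rotation number one\<close>

lemma orthonormal_frame:
  fixes a v w :: "real ^ 2"
  assumes "a \<bullet> a = 1"
  shows "v \<bullet> w = (v \<bullet> a) * (w \<bullet> a) + (v \<bullet> rot90 a) * (w \<bullet> rot90 a)"
    and "rot90 v \<bullet> w = (v \<bullet> a) * (w \<bullet> rot90 a) - (v \<bullet> rot90 a) * (w \<bullet> a)"
  using assms unfolding inner_real2 rot90_nth by algebra+

lemma DERIV_inner_smooth_curve: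
  assumes "smooth_curve u" "smooth_curve v"
  shows "((\<lambda>s. u s \<bullet> v s) has_real_derivative vderiv u s \<bullet> v s + u s \<bullet> vderiv v s) (at s)"
  using bounded_bilinear.has_vector_derivative[OF bounded_bilinear_inner
      smooth_curve_has_vderiv[OF assms(1)] smooth_curve_has_vderiv[OF assms(2)]]
  by (simp add: has_real_derivative_iff_has_vector_derivative add.commute)

text \<open>The tangent \<open>T\<close> with its derivatives \<open>T1\<close>, \<open>T2\<close>, \<open>T3\<close> is handled only through components in the moving
frame formed by \<open>T\<close> and the normal \<open>rot90 T\<close>. The Frenet equations appear in the form
\<open>T1 = \<kappa> N\<close>, \<open>T2 = \<kappa>' N - \<kappa>\<^sup>2 T\<close>, and only the tangential component of \<open>T3\<close>, which does not involve
\<open>\<kappa>''\<close>, is computed.\<close>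
locale unit_speed_loop =
  fixes L :: real and f :: "real \<Rightarrow> real ^ 2"
  assumes L: "0 < L" and closed: "arclength_closed_curve L f"
    and rotation: "rotation_number L f = 1"
begin

definition "T = vderiv f"
definition "T1 = vderiv T"
definition "T2 = vderiv T1"
definition "T3 = vderiv T2"

definition "\<kappa> = curvature f"
definition "\<kappa>' s = T2 s \<bullet> rot90 (T s)"
definition "\<omega> = 2 * pi / L"

lemma loop_f: "smooth_loop L f"
  using closed by (simp add: smooth_loop_def arclength_closed_curve_def)

lemma loops: "smooth_loop L T" "smooth_loop L T1" "smooth_loop L T2"
  unfolding T2_def T1_def T_def by (intro smooth_loop_vderiv loop_f)+

lemma smooth: "smooth_curve T" "smooth_curve T1" "smooth_curve T2"
  using loops by (simp_all add: smooth_loop_def)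

lemma T_T: "T s \<bullet> T s = 1"
  using closed by (simp add: T_def arclength_closed_curve_def norm_eq_1)

lemma nu_eq: "nu f s = rot90 (T s)"
  by (simp add: nu_def rot90_def T_def)

lemma T1_N: "T1 s \<bullet> rot90 (T s) = \<kappa> s"
  by (simp add: \<kappa>_def curvature_def curvature_vector_def nu_eq T1_def T_def)

lemma T1_T: "T1 s \<bullet> T s = 0"
proof -
  have "((\<lambda>s. T s \<bullet> T s) has_real_derivative T1 s \<bullet> T s + T s \<bullet> T1 s) (at s)"
    unfolding T1_def by (intro DERIV_inner_smooth_curve smooth)
  moreover have "((\<lambda>s. T s \<bullet> T s) has_real_derivative 0) (at s)" by (simp add: T_T)
  ultimately have "T1 s \<bullet> T s + T s \<bullet> T1 s = 0" by (rule DERIV_unique)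
  then show ?thesis by (simp add: inner_commute)
qed

lemma T2_T: "T2 s \<bullet> T s = - (\<kappa> s)\<^sup>2"
proof -
  have "((\<lambda>s. T1 s \<bullet> T s) has_real_derivative T2 s \<bullet> T s + T1 s \<bullet> T1 s) (at s)"
    unfolding T2_def using DERIV_inner_smooth_curve[OF smooth(2,1)] by (simp add: T1_def)
  moreover have "((\<lambda>s. T1 s \<bullet> T s) has_real_derivative 0) (at s)" by (simp add: T1_T)
  ultimately have "T2 s \<bullet> T s + T1 s \<bullet> T1 s = 0" by (rule DERIV_unique)
  then show ?thesis
    using orthonormal_frame(1)[OF T_T[of s], of "T1 s" "T1 s"] by (simp add: T1_T T1_N power2_eq_square)
qed

lemma DERIV_curvature: "(\<kappa> has_real_derivative \<kappa>' s) (at s)"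
proof -
  have J: "smooth_curve (\<lambda>s. rot90 (T s))" "vderiv (\<lambda>s. rot90 (T s)) = (\<lambda>s. rot90 (T1 s))"
    using smooth_curve_lincomb[OF smooth(1,1) linear_rot90 linear_zero]
      vderiv_lincomb[OF smooth(1,1) linear_rot90 linear_zero] by (simp_all add: T1_def)
  have "((\<lambda>s. T1 s \<bullet> rot90 (T s)) has_real_derivative
      T2 s \<bullet> rot90 (T s) + T1 s \<bullet> rot90 (T1 s)) (at s)"
    using DERIV_inner_smooth_curve[OF smooth(2) J(1)] by (simp add: J(2) T2_def)
  moreover have "T1 s \<bullet> rot90 (T1 s) = 0" by (simp add: inner_real2)
  ultimately show ?thesis by (simp add: T1_N \<kappa>'_def)
qed

lemma T3_T: "T3 s \<bullet> T s = - 3 * \<kappa> s * \<kappa>' s"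
proof -
  have "((\<lambda>s. T2 s \<bullet> T s) has_real_derivative T3 s \<bullet> T s + T2 s \<bullet> T1 s) (at s)"
    using DERIV_inner_smooth_curve[OF smooth(3,1)] by (simp add: T3_def T1_def)
  moreover have "((\<lambda>s. - (\<kappa> s)\<^sup>2) has_real_derivative - (2 * \<kappa> s * \<kappa>' s)) (at s)"
    by (auto intro!: derivative_eq_intros DERIV_curvature)
  ultimately have "T3 s \<bullet> T s + T2 s \<bullet> T1 s = - (2 * \<kappa> s * \<kappa>' s)"
    unfolding T2_T by (rule DERIV_unique)
  moreover have "T2 s \<bullet> T1 s = \<kappa> s * \<kappa>' s"
    using orthonormal_frame(1)[OF T_T[of s], of "T2 s" "T1 s"] by (simp add: T1_T T1_N \<kappa>'_def)
  ultimately show ?thesis by simp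
qed

lemma continuous_on_curvature: "continuous_on A \<kappa>"
  by (rule continuous_at_imp_continuous_on) (use DERIV_curvature DERIV_isCont in blast)

lemma has_integral_curvature: "(\<kappa> has_integral 2 * pi) {0..L}"
proof -
  have "integral {0..L} \<kappa> = 2 * pi"
    using rotation by (simp add: rotation_number_def \<kappa>_def)
  then show ?thesis
    by (metis integrable_continuous_real continuous_on_curvature integrable_integral)
qed

lemma curvature_dev_eq: "curvature_dev L f = (\<lambda>s. \<kappa> s - \<omega>)"
  using integral_unique[OF has_integral_curvature]
  by (simp add: fun_eq_iff curvature_dev_def \<kappa>_def \<omega>_def)

lemma has_integral_curvature_dev: "((\<lambda>s. \<kappa> s - \<omega>) has_integral 0) {0..L}"
  using has_integral_diff[OF has_integral_curvature has_integral_const_real[of \<omega> 0 L]] L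
  by (simp add: \<omega>_def)

lemma deriv_curvature_dev: "deriv (curvature_dev L f) s = \<kappa>' s"
  unfolding curvature_dev_eq
  by (rule DERIV_imp_deriv) (auto intro!: derivative_eq_intros DERIV_curvature)

lemma iso_op_eq: "iso_op L f s = T1 s - \<omega> *\<^sub>R rot90 (T s)"
  by (simp add: iso_op_def T1_def T_def \<omega>_def)

text \<open>For a unit speed curve the form reads \<open>L - (4 \<pi> / L) A\<close> with \<open>A\<close> the signed area.\<close>
lemma iso_form_position: "iso_form L f f = L * I_minus_one L f"
proof -
  have "continuous_on {0..L} (\<lambda>s. f s \<bullet> rot90 (T s))"
    using loop_f loops by (intro continuous_intros continuous_on_smooth_loop)
  then have i: "(\<lambda>s. f s \<bullet> rot90 (T s)) integrable_on {0..L}"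
    by (rule integrable_continuous_real)
  have "iso_form L f f = integral {0..L} (\<lambda>s. 1 + \<omega> * (f s \<bullet> rot90 (T s)))"
    unfolding iso_form_def T_def[symmetric] T_T \<omega>_def[symmetric]
    by (rule arg_cong[where f = "integral {0..L}"]) (simp add: fun_eq_iff inner_real2 algebra_simps)
  also have "\<dots> = L + \<omega> * integral {0..L} (\<lambda>s. f s \<bullet> rot90 (T s))"
    using i L by (simp add: integral_add integrable_on_mult_right integrable_const_ivl)
  finally show ?thesis
    using L by (simp add: I_minus_one_def signed_area_def nu_eq \<omega>_def field_simps power2_eq_square)
qed

text \<open>The operator \<open>iso_op\<close> sends the position to \<open>(\<kappa> - \<omega>) N\<close>, and its inner product with \<open>T1 = \<kappa> N\<close> is
\<open>\<kappa> (\<kappa> - \<omega>)\<close>. Since \<open>\<kappa> - \<omega>\<close> has integral zero (here the rotation number enters), the factor \<open>\<kappa>\<close> may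
be replaced by \<open>\<kappa> - \<omega>\<close> under the integral.\<close>
lemma iso_form_mixed: "iso_form L T1 f = - integral {0..L} (\<lambda>s. (curvature_dev L f s)\<^sup>2)"
proof -
  have sq: "((\<lambda>s. (\<kappa> s - \<omega>)\<^sup>2) has_integral integral {0..L} (\<lambda>s. (\<kappa> s - \<omega>)\<^sup>2)) {0..L}"
    by (intro integrable_integral integrable_continuous_real continuous_intros continuous_on_curvature)
  have "T1 s \<bullet> iso_op L f s = (\<kappa> s - \<omega>)\<^sup>2 + \<omega> * (\<kappa> s - \<omega>)" for s
    using orthonormal_frame(1)[OF T_T[of s], of "T1 s" "T1 s"]
    by (simp add: iso_op_eq inner_diff_right T1_T T1_N power2_eq_square algebra_simps)
  moreover have "((\<lambda>s. (\<kappa> s - \<omega>)\<^sup>2 + \<omega> * (\<kappa> s - \<omega>))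
      has_integral integral {0..L} (\<lambda>s. (\<kappa> s - \<omega>)\<^sup>2) + \<omega> * 0) {0..L}"
    by (intro has_integral_add sq has_integral_mult_right has_integral_curvature_dev)
  ultimately show ?thesis
    by (simp add: iso_form_eq_iso_op[OF L loops(2) loop_f] curvature_dev_eq integral_unique)
qed

text \<open>In the moving frame \<open>\<bar>T2\<bar>\<^sup>2 = \<kappa>\<^sup>4 + \<kappa>'\<^sup>2\<close> and \<open>rot90 T1 \<bullet> T2 = \<kappa>\<^sup>3\<close>, which gives
\<open>\<kappa>\<^sup>4 + \<kappa>'\<^sup>2 - \<omega> \<kappa>\<^sup>3\<close>. Although \<open>\<kappa>\<^sup>3 (\<kappa> - \<omega>)\<close> may change sign, the integral is thus a value of a
nonnegative quadratic form.\<close>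
lemma iso_form_curvature: "iso_form L T1 T1 = integral {0..L}
      (\<lambda>s. curvature f s ^ 3 * curvature_dev L f s + (deriv (curvature_dev L f) s) ^ 2)"
proof -
  have "T2 s \<bullet> T2 s - \<omega> * (rot90 (T1 s) \<bullet> T2 s) = \<kappa> s ^ 3 * (\<kappa> s - \<omega>) + (\<kappa>' s)\<^sup>2" for s
  proof -
    have "T2 s \<bullet> T2 s = (\<kappa> s)\<^sup>2 * (\<kappa> s)\<^sup>2 + \<kappa>' s * \<kappa>' s"
      using orthonormal_frame(1)[OF T_T[of s], of "T2 s" "T2 s"] by (simp add: T2_T \<kappa>'_def)
    moreover have "rot90 (T1 s) \<bullet> T2 s = \<kappa> s * (\<kappa> s)\<^sup>2"
      using orthonormal_frame(2)[OF T_T[of s], of "T1 s" "T2 s"] by (simp add: T2_T T1_T T1_N)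
    ultimately show ?thesis by (simp add: power2_eq_square power3_eq_cube algebra_simps)
  qed
  then show ?thesis
    unfolding iso_form_def T2_def[symmetric] \<omega>_def[symmetric] deriv_curvature_dev
    by (simp add: curvature_dev_eq \<kappa>_def[symmetric])
qed

lemma rigid_position:
  assumes "iso_form L f f = 0"
  shows "curvature_dev L f s = 0"
proof -
  have "iso_op L f s \<bullet> rot90 (T s) = 0"
    using iso_form_null[OF L loop_f assms] by simp
  moreover have "rot90 (T s) \<bullet> rot90 (T s) = 1" using T_T[of s] by (simp add: inner_real2)
  ultimately show ?thesis by (simp add: iso_op_eq inner_diff_left T1_N curvature_dev_eq)
qed

text \<open>The map \<open>u = T1 + t f\<close> satisfies \<open>iso_op L u = 0\<close>. The normal component of this equation involves
\<open>\<kappa>''\<close> and \<open>t\<close>, but the tangential one is simply \<open>\<kappa>' (3 \<kappa> - \<omega>) = 0\<close>. Hence \<open>(3 \<kappa> - \<omega>)\<^sup>2\<close> is constant, so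
\<open>\<kappa>\<close> takes at most two values; being continuous it is constant, and therefore equal to its mean \<open>\<omega>\<close>.\<close>
lemma rigid_combination:
  assumes null: "iso_form L (\<lambda>s. T1 s + t *\<^sub>R f s) (\<lambda>s. T1 s + t *\<^sub>R f s) = 0"
  shows "curvature_dev L f s = 0"
proof -
  have ode: "\<kappa>' s * (3 * \<kappa> s - \<omega>) = 0" for s
  proof -
    have "iso_op L (\<lambda>s. T1 s + t *\<^sub>R f s) s = 0"
      by (rule iso_form_null[OF L smooth_loop_add_scaleR[OF loops(2) loop_f] null])
    then have "(T3 s + t *\<^sub>R T1 s - \<omega> *\<^sub>R rot90 (T2 s + t *\<^sub>R T s)) \<bullet> T s = 0"
      using vderiv_add_scaleR[OF loops(2) loop_f, of t] vderiv_add_scaleR[OF loops(3,1), of t]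
      by (simp add: iso_op_def \<omega>_def T3_def T2_def T1_def T_def)
    moreover have "rot90 (T2 s + t *\<^sub>R T s) \<bullet> T s = - \<kappa>' s"
      by (simp add: \<kappa>'_def inner_real2 algebra_simps)
    ultimately have "- 3 * \<kappa> s * \<kappa>' s + \<omega> * \<kappa>' s = 0"
      by (simp add: inner_diff_left inner_add_left T3_T T1_T)
    then show ?thesis by algebra
  qed
  define h where "h s = 3 * \<kappa> s - \<omega>" for s
  have h': "((\<lambda>s. (h s)\<^sup>2) has_real_derivative 0) (at s)" for s
  proof -
    have "((\<lambda>s. (h s)\<^sup>2) has_real_derivative 6 * (\<kappa>' s * (3 * \<kappa> s - \<omega>))) (at s)"
      unfolding h_def by (auto intro!: derivative_eq_intros DERIV_curvature)
    then show ?thesis by (simp add: ode)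
  qed
  have "(h s)\<^sup>2 = (h 0)\<^sup>2" for s
    using DERIV_isconst_all[of "\<lambda>s. (h s)\<^sup>2" s 0] h' by simp
  then have "range h \<subseteq> {h 0, - h 0}" by (auto simp: power2_eq_iff)
  then have "finite (range h)" by (rule finite_subset) simp
  moreover have "continuous_on UNIV h"
    unfolding h_def by (intro continuous_intros continuous_on_curvature)
  ultimately have "h constant_on UNIV"
    by (intro continuous_finite_range_constant) simp_all
  then obtain c where c: "h s = c" for s unfolding constant_on_def by auto
  define d where "d = (c + \<omega>) / 3 - \<omega>"
  have d: "\<kappa> s - \<omega> = d" for s using c[of s] by (simp add: h_def d_def)
  have "((\<lambda>s. d) has_integral 0) {0..L}" using has_integral_curvature_dev by (simp only: d)
  then have "L * d = 0" using has_integral_const_real[of d 0 L] L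
    by (metis content_real diff_zero has_integral_unique less_imp_le real_scaleR_def)
  then show ?thesis using L by (simp add: curvature_dev_eq d)
qed

text \<open>Equality in Cauchy-Schwarz means that either \<open>f\<close> is a null vector or the quadratic
polynomial \<open>t \<mapsto> B(T1 + t f, T1 + t f)\<close> of the isoperimetric form \<open>B\<close> has discriminant zero, so that \<open>T1 + t f\<close> is a null vector at the minimizing \<open>t\<close>.\<close>
lemma equality_imp_constant_curvature:
  assumes eq: "(iso_form L T1 f)\<^sup>2 = iso_form L f f * iso_form L T1 T1"
  shows "curvature_dev L f s = 0"
proof (cases "iso_form L f f = 0")
  case True
  then show ?thesis by (rule rigid_position)
next
  case False
  define t where "t = - iso_form L T1 f / iso_form L f f"
  have "iso_form L (\<lambda>s. T1 s + t *\<^sub>R f s) (\<lambda>s. T1 s + t *\<^sub>R f s)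
      = iso_form L T1 T1 - (iso_form L T1 f)\<^sup>2 / iso_form L f f"
    unfolding iso_form_quadratic[OF L loops(2) loop_f] t_def using False
    by (simp add: power2_eq_square)
  also have "\<dots> = 0" using eq False by simp
  finally show ?thesis by (rule rigid_combination)
qed

end

theorem theorem2p2:
  fixes f :: "real \<Rightarrow> real ^ 2" and L :: real
  assumes "L > 0"
    and "arclength_closed_curve L f"
    and "rotation_number L f = 1"
  shows "(integral {0..L}
      (\<lambda>s. curvature f s ^ 3 * curvature_dev L f s + (deriv (curvature_dev L f) s) ^ 2) \<ge> 0)
    \<and> (I_zero L f \<le> sqrt (I_minus_one L f) *
      sqrt (L ^ 3 * integral {0..L}
      (\<lambda>s. curvature f s ^ 3 * curvature_dev L f s + (deriv (curvature_dev L f) s) ^ 2)))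
    \<and> (I_zero L f = sqrt (I_minus_one L f) *
      sqrt (L ^ 3 * integral {0..L}
      (\<lambda>s. curvature f s ^ 3 * curvature_dev L f s + (deriv (curvature_dev L f) s) ^ 2))
      \<longleftrightarrow> (\<forall>s. curvature_dev L f s = 0))"
    (is "?P \<ge> 0 \<and> ?I0 \<le> ?rhs \<and> (?I0 = ?rhs \<longleftrightarrow> ?const)")
proof -
  interpret unit_speed_loop L f by unfold_locales (fact assms)+
  define a where "a = iso_form L f f"
  define b where "b = iso_form L T1 f"
  define p where "p = iso_form L T1 T1"
  have P: "?P = p" using iso_form_curvature by (simp add: p_def)
  have p: "0 \<le> p" unfolding p_def by (rule iso_form_nonneg[OF L loops(2)])
  have I0: "?I0 = - (L * b)" unfolding I_zero_def b_def by (simp add: iso_form_mixed)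
  have "I_minus_one L f * (L ^ 3 * p) = L\<^sup>2 * (a * p)"
    by (simp add: a_def iso_form_position power2_eq_square power3_eq_cube)
  then have rhs: "?rhs = sqrt (L\<^sup>2 * (a * p))"
    unfolding P by (simp add: real_sqrt_mult[symmetric])
  have cs: "b\<^sup>2 \<le> a * p"
    using iso_form_Cauchy_Schwarz[OF L loops(2) loop_f] by (simp add: a_def b_def p_def mult.commute)
  have sq: "?I0\<^sup>2 = L\<^sup>2 * b\<^sup>2" by (simp add: I0 power_mult_distrib)
  have le: "?I0 \<le> ?rhs"
    unfolding rhs by (rule real_le_rsqrt) (simp add: sq cs mult_left_mono)
  have "?I0 = ?rhs \<longleftrightarrow> ?const"
  proof
    assume "?I0 = ?rhs"
    then have "?I0\<^sup>2 = L\<^sup>2 * (a * p)"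
      unfolding rhs using cs order_trans[OF zero_le_power2 cs] by simp
    then have "b\<^sup>2 = a * p" using sq L by simp
    then show ?const using equality_imp_constant_curvature by (simp add: a_def b_def p_def)
  next
    assume c: ?const
    then have "curvature_dev L f = (\<lambda>s. 0)" by (simp add: fun_eq_iff)
    then have "?P = 0" "?I0 = 0" by (simp_all add: I_zero_def)
    then show "?I0 = ?rhs" by simp
  qed
  then show ?thesis using P p le by simp
qed

end
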